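(* Let $L\in\mathbb{R}^{m\times n}$ be nonzero and let $A:\mathbb{R}^n\rightrightarrows\mathbb{R}^n$ and $B:\mathbb{R}^m\rightrightarrows\mathbb{R}^m$ be outer semicontinuous. Suppose that there exist $(x^\star,y^\star)\in\operatorname{zer}T_{\rm PD}$ and moduli $(\mu_A,\mu_B,\rho_A,\rho_B)\in\mathbb{R}^4$ such that $A$ is $(\mu_A L^\top L,\rho_A I_n)$-semimonotone at $(x^\star,-L^\top y^\star)\in\operatorname{gph}A$, $B$ is $(\mu_B I_m,\rho_B LL^\top)$-semimonotone at $(Lx^\star,y^\star)\in\operatorname{gph}B$, and one of the following conditions holds: (i) $\mu_A=\mu_B=0$ and $\rho_A=\rho_B=0$; (ii) $\mu_A+\mu_B>0$ and $\rho_A=\rho_B=0$; (iii) $\rho_A+\rho_B>0$ and $\mu_A=\mu_B=0$; (iv) $\mu_A+\mu_B>0$, $\rho_A+\rho_B>0$ and $\min\{0,\frac{\mu_A\mu_B}{\mu_A+\mu_B}\}\,\min\{0,\frac{\rho_A\rho_B}{\rho_A+\rho_B}\}<\frac{1}{4\|L\|^2}$. Then there exist stepsizes $\gamma,\tau>0$ and sequences of strictly positive relaxation parameters $(\lambda_k)_{k\in\mathbb{N}}$ such that, if the resolvents $J_{\gamma A}$ and $J_{\tau B^{-1}}$ have full domain, then any sequence $(\bar z^k)_{k\in\mathbb{N}}=(\bar x^k,\bar y^k)_{k\in\mathbb{N}}$ generated by the Chambolle--Pock algorithm (CPA) with these parameters, starting from $z^0\in\mathbb{R}^{n+m}$, either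 reaches a point $\bar z^k\in\operatorname{zer}T_{\rm PD}$ in a finite number of iterations, or every limit point of $(\bar z^k)_{k\in\mathbb{N}}$ belongs to $\operatorname{zer}T_{\rm PD}$.
   Context: For a set-valued operator $A:\mathbb{R}^n\rightrightarrows\mathbb{R}^n$: $\operatorname{gph}A=\{(x,y): y\in Ax\}$, $\operatorname{zer}A=\{x:0\in Ax\}$, $A^{-1}$ is the inverse relation, $J_A=(\mathrm{id}+A)^{-1}$ is the resolvent. $A$ is outer semicontinuous if its graph is closed. $\|L\|$ is the spectral norm. For symmetric (possibly indefinite) matrices $M,R\in\mathbb{R}^{n\times n}$, $A$ is $(M,R)$-semimonotone at $(x',y')\in\operatorname{gph}A$ if $\langle x-x',y-y'\rangle\ge\langle x-x',M(x-x')\rangle+\langle y-y',R(y-y')\rangle$ for all $(x,y)\in\operatorname{gph}A$. Primal-dual operator: $T_{\rm PD}:\mathbb{R}^{n+m}\rightrightarrows\mathbb{R}^{n+m}$, $T_{\rm PD}(x,y)=(Ax+L^\top y)\times(B^{-1}y-Lx)$. One has $(x,y)\in\operatorname{zer}T_{\rm PD}$ iff $(x,-L^\top y)\in\operatorname{gph}A$ and $(Lx,y)\in\operatorname{gph}B$. Chambolle--Pock algorithm (CPA): given $\gamma,\tau>0$, $\lambda_k>0$ and $z^0=(x^0,y^0)\in\mathbb{R}^{n+m}$, iterate for $k\in\mathbb N$: $\bar x^k\in J_{\gamma A}(x^k-\gamma L^\top y^k)$, $\bar y^k\in J_{\tau B^{-1}}(y^k+\tau L(2\bar x^k-x^k))$,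 $x^{k+1}=x^k+\lambda_k(\bar x^k-x^k)$, $y^{k+1}=y^k+\lambda_k(\bar y^k-y^k)$. *)

theory Defs
  imports "HOL-Analysis.Analysis"
begin

text \<open>A set-valued operator from \<open>'a\<close> to \<open>'b\<close> is a function \<open>'a \<Rightarrow> 'b set\<close>.\<close>

definition gph :: "('a \<Rightarrow> 'b set) \<Rightarrow> ('a \<times> 'b) set" where
  "gph A = {(x, y). y \<in> A x}"

definition zer :: "('a \<Rightarrow> 'b::zero set) \<Rightarrow> 'a set" where
  "zer A = {x. 0 \<in> A x}"

definition inv_op :: "('a \<Rightarrow> 'b set) \<Rightarrow> 'b \<Rightarrow> 'a set" where
  "inv_op A = (\<lambda>y. {x. y \<in> A x})"

definition scale_op :: "real \<Rightarrow> ('a \<Rightarrow> 'b::real_vector set) \<Rightarrow> 'a \<Rightarrow> 'b set" where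
  "scale_op c A = (\<lambda>x. {c *\<^sub>R u | u. u \<in> A x})"

definition resolvent :: "('a::ab_group_add \<Rightarrow> 'a set) \<Rightarrow> 'a \<Rightarrow> 'a set" where
  "resolvent A = inv_op (\<lambda>x. {x + u | u. u \<in> A x})"

definition full_domain :: "('a \<Rightarrow> 'b set) \<Rightarrow> bool" where
  "full_domain A \<longleftrightarrow> (\<forall>x. A x \<noteq> {})"

definition outer_semicontinuous ::
  "('a::topological_space \<Rightarrow> 'b::topological_space set) \<Rightarrow> bool" where
  "outer_semicontinuous A \<longleftrightarrow> closed (gph A)"

definition semimonotone_at ::
  "real^'n^'n \<Rightarrow> real^'n^'n \<Rightarrow> (real^'n \<Rightarrow> (real^'n) set) \<Rightarrow> real^'n \<Rightarrow> real^'n \<Rightarrow> bool" where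
  "semimonotone_at M R A x' y' \<longleftrightarrow>
     transpose M = M \<and> transpose R = R \<and> (x', y') \<in> gph A \<and>
     (\<forall>(x, y) \<in> gph A.
        (x - x') \<bullet> (y - y') \<ge> (x - x') \<bullet> (M *v (x - x')) + (y - y') \<bullet> (R *v (y - y')))"

definition spectral_norm :: "real^'n^'m \<Rightarrow> real" where
  "spectral_norm L = onorm (\<lambda>x. L *v x)"

text \<open>The space \<open>\<real>\<^sup>n\<^sup>+\<^sup>m\<close> is rendered as the product type \<open>(real^'n) \<times> (real^'m)\<close>.\<close>

definition T_PD ::
  "(real^'n \<Rightarrow> (real^'n) set) \<Rightarrow> (real^'m \<Rightarrow> (real^'m) set) \<Rightarrow> real^'n^'m
    \<Rightarrow> (real^'n) \<times> (real^'m) \<Rightarrow> ((real^'n) \<times> (real^'m)) set" where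
  "T_PD A B L = (\<lambda>(x, y).
     {u + transpose L *v y | u. u \<in> A x} \<times> {v - L *v x | v. v \<in> inv_op B y})"

text \<open>\<open>CPA A B L \<gamma> \<tau> lam x y xb yb\<close>: the iterates \<open>z\<^sup>k = (x k, y k)\<close> and
  \<open>(xb k, yb k)\<close> (the barred iterates) form a run of the algorithm. The resolvents may be
  multivalued, so a run need not be determined by its starting point \<open>(x 0, y 0)\<close>.\<close>

definition CPA ::
  "(real^'n \<Rightarrow> (real^'n) set) \<Rightarrow> (real^'m \<Rightarrow> (real^'m) set) \<Rightarrow> real^'n^'m
    \<Rightarrow> real \<Rightarrow> real \<Rightarrow> (nat \<Rightarrow> real)
    \<Rightarrow> (nat \<Rightarrow> real^'n) \<Rightarrow> (nat \<Rightarrow> real^'m) \<Rightarrow> (nat \<Rightarrow> real^'n) \<Rightarrow> (nat \<Rightarrow> real^'m) \<Rightarrow> bool" where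
  "CPA A B L \<gamma> \<tau> lam x y xb yb \<longleftrightarrow>
     (\<forall>k. xb k \<in> resolvent (scale_op \<gamma> A) (x k - \<gamma> *\<^sub>R (transpose L *v y k)) \<and>
          yb k \<in> resolvent (scale_op \<tau> (inv_op B))
                    (y k + \<tau> *\<^sub>R (L *v (2 *\<^sub>R xb k - x k))) \<and>
          x (Suc k) = x k + lam k *\<^sub>R (xb k - x k) \<and>
          y (Suc k) = y k + lam k *\<^sub>R (yb k - y k))"

text \<open>Limit points of a sequence are limits of subsequences; this differs from \<open>islimpt\<close> of
  the range (e.g. for constant sequences).\<close>

definition seq_limit_point :: "(nat \<Rightarrow> 'a::topological_space) \<Rightarrow> 'a \<Rightarrow> bool" where
  "seq_limit_point s p \<longleftrightarrow> (\<exists>r. strict_mono r \<and> (s \<circ> r) \<longlonglongrightarrow> p)"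

end

theory Submission
  imports Defs
begin

text \<open>
  The algorithm is a relaxed proximal point method for the primal-dual operator \<open>T\<close>,
  preconditioned by \<open>P = [I/\<gamma>, -L\<^sup>T; -L, I/\<tau>]\<close>: the vector \<open>w = P (z - z')\<close>, where \<open>z'\<close> is the
  barred iterate, lies in \<open>T z'\<close>. Adding the two semimonotonicity inequalities and minimizing over
  the directions not seen by \<open>w\<close> gives the weak Minty inequality
  \<open>\<langle>w, z' - z*\<rangle> \<ge> - a |w\<^sub>1|\<^sup>2 - b |w\<^sub>2|\<^sup>2\<close>, where \<open>a, b\<close> can be enlarged to be strictly positive while
  \<open>4 a b |L|\<^sup>2 < 1\<close>. For \<open>\<gamma> = 2 a\<close> and \<open>\<tau> = 2 b\<close> the cross terms of \<open>P - P diag(a, b) P\<close> cancel, and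
  this matrix is positive definite, as is \<open>P\<close>. Hence for a small constant relaxation parameter
  \<open>|z - z*|\<^sub>P\<^sup>2\<close> decreases by at least a multiple of \<open>|z - z'|\<^sup>2\<close> in each iteration, so \<open>z - z'\<close> and
  \<open>w\<close> tend to zero, and the closed graphs of \<open>A\<close> and \<open>B\<close> show that limit points of \<open>z'\<close> are zeros.
\<close>

section \<open>Adjoint and spectral norm\<close>

lemma transpose_inner:
  fixes L :: "real^'n^'m"
  shows "(transpose L *v y) \<bullet> x = y \<bullet> (L *v x)"
  by (simp add: dot_lmul_matrix)

lemma norm_mult_le_spectral_norm: "norm (L *v x) \<le> spectral_norm L * norm x"
  unfolding spectral_norm_def by (rule onorm) (rule matrix_vector_mul_bounded_linear)

lemma spectral_norm_nonneg: "0 \<le> spectral_norm L"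
  unfolding spectral_norm_def by (rule onorm_pos_le) (rule matrix_vector_mul_bounded_linear)

text \<open>Testing \<open>L\<close> on the vector \<open>transpose L *v y\<close> itself and
  applying Cauchy-Schwarz bounds its squared norm; one factor of the norm is then cancelled.\<close>

lemma norm_transpose_mult_le_spectral_norm:
  "norm (transpose L *v y) \<le> spectral_norm L * norm y"
proof (cases "transpose L *v y = 0")
  case True
  then show ?thesis by (simp add: spectral_norm_nonneg)
next
  case False
  let ?v = "transpose L *v y"
  have "norm ?v * norm ?v = y \<bullet> (L *v ?v)"
    by (metis transpose_inner power2_norm_eq_inner power2_eq_square)
  also have "\<dots> \<le> norm y * norm (L *v ?v)"
    by (rule norm_cauchy_schwarz)
  also have "\<dots> \<le> norm y * (spectral_norm L * norm ?v)"
    by (intro mult_left_mono norm_mult_le_spectral_norm) simp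
  finally have "norm ?v * norm ?v \<le> (spectral_norm L * norm y) * norm ?v"
    by (simp add: mult_ac)
  then show ?thesis using False by simp
qed

section \<open>Parallel sums and the weak Minty inequality\<close>

text \<open>Completing the square in \<open>u\<close>: the right-hand side is minimal at
  \<open>u = - (q / (p + q)) *\<^sub>R w\<close>. Only the sum \<open>p + q\<close> has to be
  positive, so one of the moduli may be negative.\<close>

lemma parallel_sum_le:
  fixes u w :: "'a::real_inner"
  assumes "p + q > 0"
  shows "p * q / (p + q) * (w \<bullet> w) \<le> p * (u \<bullet> u) + q * ((u + w) \<bullet> (u + w))"
proof -
  have "(p + q) * (p * (u \<bullet> u) + q * ((u + w) \<bullet> (u + w))) - p * q * (w \<bullet> w)
      = ((p + q) *\<^sub>R u + q *\<^sub>R w) \<bullet> ((p + q) *\<^sub>R u + q *\<^sub>R w)"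
    by (simp add: algebra_simps inner_commute)
  then have "p * q * (w \<bullet> w) \<le> (p + q) * (p * (u \<bullet> u) + q * ((u + w) \<bullet> (u + w)))"
    by (metis inner_ge_zero diff_ge_0_iff_ge)
  then show ?thesis using assms by (simp add: field_simps)
qed

text \<open>Here \<open>c\<close> is the negative part of the parallel sum of \<open>p\<close> and
  \<open>q\<close>. If both moduli vanish, the right-hand side is zero and \<open>a \<ge> 0\<close>
  suffices. The slack \<open>c \<le> a\<close> leaves room to make the constant strictly
  positive.\<close>

lemma weak_parallel_sum_le:
  fixes u w :: "'a::real_inner"
  assumes "p + q > 0 \<or> p = 0 \<and> q = 0"
    and "c = (if p + q > 0 then - min 0 (p * q / (p + q)) else 0)" and "c \<le> a"
  shows "- a * (w \<bullet> w) \<le> p * (u \<bullet> u) + q * ((u + w) \<bullet> (u + w))"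
proof (cases "p + q > 0")
  case True
  then have "- a \<le> p * q / (p + q)" using assms by auto
  then have "- a * (w \<bullet> w) \<le> p * q / (p + q) * (w \<bullet> w)"
    by (intro mult_right_mono) auto
  with parallel_sum_le[OF True, of w u] show ?thesis by linarith
qed (use assms in auto)

text \<open>The matrix moduli make the quadratic terms pair up: \<mu>A and \<mu>B act on
  \<open>L *v dx\<close> and its shift by \<open>w2\<close>, while \<rho>B and \<rho>A act on
  \<open>- (transpose L *v dy)\<close> and its shift by \<open>w1\<close>. The hypotheses
  \<open>primal\<close> and \<open>dual\<close> bound each pair below by the residual alone.\<close>

lemma weak_minty:
  fixes L :: "real^'n^'m"
  assumes A: "semimonotone_at (\<mu>A *\<^sub>R (transpose L ** L)) (\<rho>A *\<^sub>R mat 1) A xs (- (transpose L *v ys))"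
    and B: "semimonotone_at (\<mu>B *\<^sub>R mat 1) (\<rho>B *\<^sub>R (L ** transpose L)) B (L *v xs) ys"
    and primal: "\<And>(u::real^'n) w. - a * (w \<bullet> w) \<le> \<rho>B * (u \<bullet> u) + \<rho>A * ((u + w) \<bullet> (u + w))"
    and dual: "\<And>(u::real^'m) w. - b * (w \<bullet> w) \<le> \<mu>A * (u \<bullet> u) + \<mu>B * ((u + w) \<bullet> (u + w))"
    and w: "(w1, w2) \<in> T_PD A B L (x, y)"
  shows "- a * (w1 \<bullet> w1) - b * (w2 \<bullet> w2) \<le> w1 \<bullet> (x - xs) + w2 \<bullet> (y - ys)"
proof -
  obtain u v where u: "u \<in> A x" "w1 = u + transpose L *v y"
    and v: "y \<in> B v" "w2 = v - L *v x"
    using w unfolding T_PD_def inv_op_def by auto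
  define dx dy where "dx = x - xs" and "dy = y - ys"
  have du: "u - - (transpose L *v ys) = - (transpose L *v dy) + w1"
    by (simp add: u dy_def matrix_vector_mult_diff_distrib)
  have dv: "v - L *v xs = L *v dx + w2"
    by (simp add: v dx_def matrix_vector_mult_diff_distrib)
  have 1: "\<mu>A * ((L *v dx) \<bullet> (L *v dx))
      + \<rho>A * ((- (transpose L *v dy) + w1) \<bullet> (- (transpose L *v dy) + w1))
      \<le> dx \<bullet> (- (transpose L *v dy) + w1)"
  proof -
    have "(x, u) \<in> gph A" using u by (simp add: gph_def)
    then have "dx \<bullet> ((\<mu>A *\<^sub>R (transpose L ** L)) *v dx)
      + (u - - (transpose L *v ys)) \<bullet> ((\<rho>A *\<^sub>R mat 1) *v (u - - (transpose L *v ys)))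
      \<le> dx \<bullet> (u - - (transpose L *v ys))"
      using A unfolding semimonotone_at_def dx_def by blast
    moreover have "dx \<bullet> ((\<mu>A *\<^sub>R (transpose L ** L)) *v dx) = \<mu>A * ((L *v dx) \<bullet> (L *v dx))"
      by (metis scaleR_matrix_vector_assoc inner_scaleR_right matrix_vector_mul_assoc
          transpose_inner inner_commute)
    ultimately show ?thesis
      unfolding du by (auto simp: scaleR_matrix_vector_assoc[symmetric])
  qed
  have 2: "\<mu>B * ((L *v dx + w2) \<bullet> (L *v dx + w2))
      + \<rho>B * ((transpose L *v dy) \<bullet> (transpose L *v dy)) \<le> (L *v dx + w2) \<bullet> dy"
  proof -
    have "(v, y) \<in> gph B" using v by (simp add: gph_def)
    then have "(v - L *v xs) \<bullet> ((\<mu>B *\<^sub>R mat 1) *v (v - L *v xs))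
      + dy \<bullet> ((\<rho>B *\<^sub>R (L ** transpose L)) *v dy) \<le> (v - L *v xs) \<bullet> dy"
      using B unfolding semimonotone_at_def dy_def by blast
    moreover have "dy \<bullet> ((\<rho>B *\<^sub>R (L ** transpose L)) *v dy)
        = \<rho>B * ((transpose L *v dy) \<bullet> (transpose L *v dy))"
      by (metis scaleR_matrix_vector_assoc inner_scaleR_right matrix_vector_mul_assoc
          transpose_inner)
    ultimately show ?thesis
      unfolding dv by (auto simp: scaleR_matrix_vector_assoc[symmetric])
  qed
  \<comment> \<open>The coupling of the primal and dual variables through \<open>L\<close> is skew,
    so it drops out of the sum.\<close>
  have "dx \<bullet> (- (transpose L *v dy) + w1) + (L *v dx + w2) \<bullet> dy = w1 \<bullet> dx + w2 \<bullet> dy"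
    using transpose_inner[of L dy dx]
    by (simp add: inner_commute inner_add_left inner_add_right inner_diff_right)
  with 1 2 primal[of w1 "- (transpose L *v dy)"] dual[of w2 "L *v dx"] show ?thesis
    by (simp add: dx_def dy_def)
qed

section \<open>The preconditioner as a quadratic form\<close>

text \<open>This is \<langle>z, P z\<rangle> for z = (x, y) and stepsizes \<open>2 * a\<close>,
  \<open>2 * b\<close>; \<open>cp_w1\<close> and \<open>cp_w2\<close> below are the two components
  of P z.\<close>

definition cp_form :: "real \<Rightarrow> real \<Rightarrow> real^'n^'m \<Rightarrow> real^'n \<Rightarrow> real^'m \<Rightarrow> real" where
  "cp_form a b L x y = (x \<bullet> x) / (2 * a) + (y \<bullet> y) / (2 * b) - 2 * (y \<bullet> (L *v x))"

definition cp_w1 :: "real \<Rightarrow> real^'n^'m \<Rightarrow> real^'n \<Rightarrow> real^'m \<Rightarrow> real^'n" where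
  "cp_w1 a L x y = (1 / (2 * a)) *\<^sub>R x - transpose L *v y"

definition cp_w2 :: "real \<Rightarrow> real^'n^'m \<Rightarrow> real^'n \<Rightarrow> real^'m \<Rightarrow> real^'m" where
  "cp_w2 b L x y = (1 / (2 * b)) *\<^sub>R y - L *v x"

text \<open>Cauchy-Schwarz followed by a weighted arithmetic-geometric mean inequality. The absolute
  value serves both the lower and the upper bound on \<open>cp_form\<close>.\<close>

lemma cp_form_cross_le:
  assumes "a > 0" "b > 0" "4 * a * b * (spectral_norm L)\<^sup>2 \<le> 1"
  shows "2 * \<bar>y \<bullet> (L *v x)\<bar> \<le> (x \<bullet> x) / (2 * a) + (y \<bullet> y) / (2 * b)"
proof -
  define l where "l = spectral_norm L"
  have l0: "l \<ge> 0" by (simp add: l_def spectral_norm_nonneg)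
  have "\<bar>y \<bullet> (L *v x)\<bar> \<le> norm y * norm (L *v x)"
    by (rule Cauchy_Schwarz_ineq2)
  also have "\<dots> \<le> norm y * (l * norm x)"
    unfolding l_def by (intro mult_left_mono norm_mult_le_spectral_norm) simp
  finally have 1: "2 * \<bar>y \<bullet> (L *v x)\<bar> \<le> 2 * l * norm x * norm y"
    by (simp add: mult_ac)
  \<comment> \<open>The weight is chosen so that, after multiplication by \<open>b\<close>, the
    hypothesis bounds the \<open>y\<close>-term by \<open>a * (norm y)\<^sup>2\<close>.\<close>
  have sq: "0 \<le> (norm x - 2 * a * l * norm y)\<^sup>2" by simp
  have "4 * a * b * l\<^sup>2 * (norm y)\<^sup>2 \<le> 1 * (norm y)\<^sup>2"
    using assms(3) unfolding l_def by (intro mult_right_mono) auto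
  then have "a * (4 * a * b * l\<^sup>2 * (norm y)\<^sup>2) \<le> a * (norm y)\<^sup>2"
    using assms(1) by (intro mult_left_mono) auto
  moreover have "0 \<le> b * (norm x - 2 * a * l * norm y)\<^sup>2" using assms(2) sq by simp
  ultimately have "4 * a * b * l * norm x * norm y \<le> b * (norm x)\<^sup>2 + a * (norm y)\<^sup>2"
    by (simp add: power2_eq_square algebra_simps)
  then have "2 * l * norm x * norm y \<le> (norm x)\<^sup>2 / (2 * a) + (norm y)\<^sup>2 / (2 * b)"
    using assms(1,2) by (simp add: field_simps)
  with 1 show ?thesis by (simp add: power2_norm_eq_inner)
qed

lemma cp_form_nonneg:
  assumes "a > 0" "b > 0" "4 * a * b * (spectral_norm L)\<^sup>2 \<le> 1"
  shows "0 \<le> cp_form a b L x y"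
  using cp_form_cross_le[OF assms, of y x] unfolding cp_form_def by linarith

lemma cp_form_le:
  assumes "a > 0" "b > 0" "4 * a * b * (spectral_norm L)\<^sup>2 \<le> 1"
  shows "cp_form a b L x y \<le> (1 / a + 1 / b) * (x \<bullet> x + y \<bullet> y)"
proof -
  have "cp_form a b L x y \<le> (x \<bullet> x) / a + (y \<bullet> y) / b"
    using cp_form_cross_le[OF assms, of y x] unfolding cp_form_def by (simp add: field_simps)
  also have "\<dots> \<le> (1 / a + 1 / b) * (x \<bullet> x + y \<bullet> y)"
  proof -
    have "0 \<le> (y \<bullet> y) / a" "0 \<le> (x \<bullet> x) / b" using assms by auto
    then show ?thesis by (simp add: distrib_left distrib_right)
  qed
  finally show ?thesis .
qed

text \<open>Expansion of the squared P-norm of Z - t z, using the symmetry of P. With Z the error of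
  an iterate and z its difference to the barred iterate, Z - t z is the error after a relaxed
  step.\<close>

lemma cp_form_shift:
  "cp_form a b L (X - t *\<^sub>R x) (Y - t *\<^sub>R y)
    = cp_form a b L X Y - 2 * t * (cp_w1 a L x y \<bullet> X + cp_w2 b L x y \<bullet> Y)
      + t\<^sup>2 * cp_form a b L x y"
  unfolding cp_form_def cp_w1_def cp_w2_def
  by (simp add: inner_diff_left inner_diff_right dot_lmul_matrix matrix_vector_mult_diff_distrib
      matrix_vector_mult_scaleR inner_commute[of "L *v _"] inner_commute[of X x]
      inner_commute[of Y y] power2_eq_square)
    (simp add: algebra_simps diff_divide_distrib add_divide_distrib)

lemma cp_form_eq_inner: "cp_form a b L x y = cp_w1 a L x y \<bullet> x + cp_w2 b L x y \<bullet> y"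
  unfolding cp_form_def cp_w1_def cp_w2_def
  by (simp add: inner_diff_left dot_lmul_matrix inner_commute[of "L *v _"])

lemma cp_form_coercive:
  assumes "a > 0" "b > 0"
  shows "(1 / (4 * a) - b * (spectral_norm L)\<^sup>2) * (x \<bullet> x)
      + (1 / (4 * b) - a * (spectral_norm L)\<^sup>2) * (y \<bullet> y)
    \<le> cp_form a b L x y - a * (cp_w1 a L x y \<bullet> cp_w1 a L x y) - b * (cp_w2 b L x y \<bullet> cp_w2 b L x y)"
proof -
  have eq: "cp_form a b L x y - a * (cp_w1 a L x y \<bullet> cp_w1 a L x y)
      - b * (cp_w2 b L x y \<bullet> cp_w2 b L x y)
    = (x \<bullet> x) / (4 * a) + (y \<bullet> y) / (4 * b)
      - a * ((transpose L *v y) \<bullet> (transpose L *v y)) - b * ((L *v x) \<bullet> (L *v x))"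
    unfolding cp_form_def cp_w1_def cp_w2_def using assms
    by (simp add: inner_diff_left inner_diff_right inner_commute[of x "y v* L"]
        dot_lmul_matrix[of y L x] inner_commute[of "L *v x" y])
      (simp add: field_simps)
  have "(L *v x) \<bullet> (L *v x) \<le> (spectral_norm L)\<^sup>2 * (x \<bullet> x)"
    using power_mono[OF norm_mult_le_spectral_norm[of L x], of 2]
    by (simp add: power_mult_distrib power2_norm_eq_inner)
  moreover have "(transpose L *v y) \<bullet> (transpose L *v y) \<le> (spectral_norm L)\<^sup>2 * (y \<bullet> y)"
    using power_mono[OF norm_transpose_mult_le_spectral_norm[of L y], of 2]
    by (simp add: power_mult_distrib power2_norm_eq_inner)
  ultimately have "b * ((L *v x) \<bullet> (L *v x)) \<le> b * ((spectral_norm L)\<^sup>2 * (x \<bullet> x))"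
    "a * ((transpose L *v y) \<bullet> (transpose L *v y)) \<le> a * ((spectral_norm L)\<^sup>2 * (y \<bullet> y))"
    using assms by (auto intro: mult_left_mono)
  then show ?thesis unfolding eq by (simp add: left_diff_distrib mult.assoc)
qed

section \<open>The iteration and its limit points\<close>

text \<open>Unfolding the resolvents shows that P (z - z') lies in T z', expressed through the
  graphs of \<open>A\<close> and \<open>B\<close>.\<close>

lemma CPA_step:
  assumes "CPA A B L (2 * a) (2 * b) lam x y xb yb" "a > 0" "b > 0"
  shows "cp_w1 a L (x k - xb k) (y k - yb k) - transpose L *v yb k \<in> A (xb k)"
    and "yb k \<in> B (cp_w2 b L (x k - xb k) (y k - yb k) + L *v xb k)"
proof -
  obtain u where u: "u \<in> A (xb k)" "x k - (2 * a) *\<^sub>R (transpose L *v y k) = xb k + (2 * a) *\<^sub>R u"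
    using assms(1) unfolding CPA_def resolvent_def inv_op_def scale_op_def by blast
  have "(2 * a) *\<^sub>R u = (x k - xb k) - (2 * a) *\<^sub>R (transpose L *v y k)"
    using u(2) by (simp add: algebra_simps)
  then have "(1 / (2 * a)) *\<^sub>R ((2 * a) *\<^sub>R u)
      = (1 / (2 * a)) *\<^sub>R ((x k - xb k) - (2 * a) *\<^sub>R (transpose L *v y k))" by simp
  then have "u = (1 / (2 * a)) *\<^sub>R (x k - xb k) - transpose L *v y k"
    using assms(2) by (simp add: scaleR_diff_right)
  then have "u = cp_w1 a L (x k - xb k) (y k - yb k) - transpose L *v yb k"
    unfolding cp_w1_def by (simp add: matrix_vector_mult_diff_distrib)
  with u(1) show "cp_w1 a L (x k - xb k) (y k - yb k) - transpose L *v yb k \<in> A (xb k)" by simp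
  obtain v where v: "yb k \<in> B v"
    "y k + (2 * b) *\<^sub>R (L *v (2 *\<^sub>R xb k - x k)) = yb k + (2 * b) *\<^sub>R v"
    using assms(1) unfolding CPA_def resolvent_def inv_op_def scale_op_def by blast
  have "(2 * b) *\<^sub>R v = (y k - yb k) + (2 * b) *\<^sub>R (L *v (2 *\<^sub>R xb k - x k))"
    using v(2) by (simp add: algebra_simps)
  then have "(1 / (2 * b)) *\<^sub>R ((2 * b) *\<^sub>R v)
      = (1 / (2 * b)) *\<^sub>R ((y k - yb k) + (2 * b) *\<^sub>R (L *v (2 *\<^sub>R xb k - x k)))" by simp
  then have "v = (1 / (2 * b)) *\<^sub>R (y k - yb k) + L *v (2 *\<^sub>R xb k - x k)"
    using assms(3) by (simp add: scaleR_add_right)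
  \<comment> \<open>The extrapolated point is \<open>xb k - (x k - xb k)\<close>; its second part
    supplies the lower left block of P and makes P symmetric.\<close>
  then have "v = cp_w2 b L (x k - xb k) (y k - yb k) + L *v xb k"
    unfolding cp_w2_def
    by (simp only: scaleR_2 matrix_vector_mult_diff_distrib matrix_vector_right_distrib) simp
  with v(1) show "yb k \<in> B (cp_w2 b L (x k - xb k) (y k - yb k) + L *v xb k)" by simp
qed

text \<open>\<open>V\<close> decreases and is bounded below, hence converges; its successive
  differences tend to zero and dominate \<open>e * D k\<close>.\<close>

lemma telescoping_tendsto_0:
  fixes V D :: "nat \<Rightarrow> real"
  assumes "\<And>k. 0 \<le> V k" "\<And>k. 0 \<le> D k" "e > 0" "\<And>k. V (Suc k) \<le> V k - e * D k"
  shows "D \<longlonglongrightarrow> 0"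
proof -
  have "V (Suc k) \<le> V k" for k
    using assms(4)[of k] mult_nonneg_nonneg[of e "D k"] assms(2)[of k] assms(3) by linarith
  then have "decseq V" by (simp add: decseq_Suc_iff)
  then obtain c where c: "V \<longlonglongrightarrow> c"
    using decseq_convergent[of V 0] assms(1) by metis
  have "(\<lambda>k. (V k - V (Suc k)) / e) \<longlonglongrightarrow> (c - c) / e"
    by (intro tendsto_intros c LIMSEQ_Suc) (use assms in auto)
  then have lim: "(\<lambda>k. (V k - V (Suc k)) / e) \<longlonglongrightarrow> 0" by simp
  show ?thesis
  proof (rule tendsto_sandwich[OF _ _ tendsto_const lim])
    show "\<forall>\<^sub>F k in sequentially. D k \<le> (V k - V (Suc k)) / e"
    proof (intro always_eventually allI)
      fix k show "D k \<le> (V k - V (Suc k)) / e"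
        using assms(4)[of k] assms(3) by (simp add: field_simps)
    qed
  qed (use assms in simp)
qed

text \<open>The residuals are attached to the barred iterates, so along the subsequence the graph
  points of \<open>A\<close> and \<open>B\<close> converge to
  \<open>(px, - (transpose L *v py))\<close> and \<open>(L *v px, py)\<close>, and closedness
  applies.\<close>

lemma limit_point_in_zer_T_PD:
  fixes L :: "real^'n^'m"
  assumes A: "outer_semicontinuous A" and B: "outer_semicontinuous B"
    and w1: "w1 \<longlonglongrightarrow> 0" and w2: "w2 \<longlonglongrightarrow> 0"
    and inA: "\<And>k. w1 k - transpose L *v yb k \<in> A (xb k)"
    and inB: "\<And>k. yb k \<in> B (w2 k + L *v xb k)"
    and p: "seq_limit_point (\<lambda>k. (xb k, yb k)) p"
  shows "p \<in> zer (T_PD A B L)"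
proof -
  obtain r where r: "strict_mono r" "((\<lambda>k. (xb k, yb k)) \<circ> r) \<longlonglongrightarrow> p"
    using p unfolding seq_limit_point_def by blast
  obtain px py where p_eq: "p = (px, py)" by (cases p)
  have x: "(\<lambda>k. xb (r k)) \<longlonglongrightarrow> px" and y: "(\<lambda>k. yb (r k)) \<longlonglongrightarrow> py"
    using tendsto_fst[OF r(2)] tendsto_snd[OF r(2)] by (simp_all add: p_eq o_def)
  have w: "(\<lambda>k. w1 (r k)) \<longlonglongrightarrow> 0" "(\<lambda>k. w2 (r k)) \<longlonglongrightarrow> 0"
    using LIMSEQ_subseq_LIMSEQ[OF w1 r(1)] LIMSEQ_subseq_LIMSEQ[OF w2 r(1)]
    by (simp_all add: o_def)
  have "(\<lambda>k. (xb (r k), w1 (r k) - transpose L *v yb (r k)))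
      \<longlonglongrightarrow> (px, 0 - transpose L *v py)"
    by (intro tendsto_intros x y w bounded_linear.tendsto[OF matrix_vector_mul_bounded_linear])
  then have 1: "- (transpose L *v py) \<in> A px"
    using closed_sequentially[OF A[unfolded outer_semicontinuous_def],
        of "\<lambda>k. (xb (r k), w1 (r k) - transpose L *v yb (r k))"
        "(px, 0 - transpose L *v py)"] inA
    by (simp add: gph_def)
  have "(\<lambda>k. (w2 (r k) + L *v xb (r k), yb (r k))) \<longlonglongrightarrow> (0 + L *v px, py)"
    by (intro tendsto_intros x y w bounded_linear.tendsto[OF matrix_vector_mul_bounded_linear])
  then have 2: "py \<in> B (L *v px)"
    using closed_sequentially[OF B[unfolded outer_semicontinuous_def],
        of "\<lambda>k. (w2 (r k) + L *v xb (r k), yb (r k))" "(0 + L *v px, py)"] inB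
    by (simp add: gph_def)
  have "\<exists>u. 0 = u + transpose L *v py \<and> u \<in> A px" "\<exists>v. 0 = v - L *v px \<and> py \<in> B v"
    using 1 2 by (metis add.left_inverse, metis diff_self)
  then show ?thesis
    by (auto simp: p_eq zer_def T_PD_def inv_op_def zero_prod_def)
qed

lemma CPA_limit_points:
  fixes L :: "real^'n^'m"
  assumes osc: "outer_semicontinuous A" "outer_semicontinuous B"
    and ab: "a > 0" "b > 0" "4 * a * b * (spectral_norm L)\<^sup>2 < 1"
    and minty: "\<And>w1 w2 x y. (w1, w2) \<in> T_PD A B L (x, y) \<Longrightarrow>
      - a * (w1 \<bullet> w1) - b * (w2 \<bullet> w2) \<le> w1 \<bullet> (x - xs) + w2 \<bullet> (y - ys)"
  shows "\<exists>t>0. \<forall>x y xb yb p. CPA A B L (2 * a) (2 * b) (\<lambda>_. t) x y xb yb \<longrightarrow>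
      seq_limit_point (\<lambda>k. (xb k, yb k)) p \<longrightarrow> p \<in> zer (T_PD A B L)"
proof -
  define c1 where "c1 = 1 / (4 * a) - b * (spectral_norm L)\<^sup>2"
  define c2 where "c2 = 1 / (4 * b) - a * (spectral_norm L)\<^sup>2"
  define c where "c = min c1 c2"
  define C where "C = 1 / a + 1 / b"
  \<comment> \<open>One step lowers \<open>V\<close> by at least
    \<open>(2 * t * c - t\<^sup>2 * C) * D k\<close>; this \<open>t\<close> maximizes the factor,
    whose value is then \<open>t * c\<close>.\<close>
  define t where "t = c / C"
  have "c1 > 0" "c2 > 0"
    using ab by (simp_all add: c1_def c2_def field_simps)
  then have c: "c > 0" by (simp add: c_def)
  have C: "C > 0" using ab by (simp add: C_def add_pos_pos)
  have t: "t > 0" using c C by (simp add: t_def)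
  have ab': "4 * a * b * (spectral_norm L)\<^sup>2 \<le> 1" using ab by simp
  have "p \<in> zer (T_PD A B L)"
    if cpa: "CPA A B L (2 * a) (2 * b) (\<lambda>_. t) x y xb yb"
      and p: "seq_limit_point (\<lambda>k. (xb k, yb k)) p" for x y xb yb p
  proof -
    define dx dy where "dx k = x k - xb k" and "dy k = y k - yb k" for k
    define w1 w2 where "w1 k = cp_w1 a L (dx k) (dy k)" and "w2 k = cp_w2 b L (dx k) (dy k)" for k
    define V where "V k = cp_form a b L (x k - xs) (y k - ys)" for k
    define D where "D k = dx k \<bullet> dx k + dy k \<bullet> dy k" for k
    note inA = CPA_step(1)[OF cpa ab(1,2), folded dx_def dy_def, folded w1_def]
      and inB = CPA_step(2)[OF cpa ab(1,2), folded dx_def dy_def, folded w2_def]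
    have step: "V (Suc k) \<le> V k - t * c * D k" for k
    proof -
      have "(w1 k, w2 k) \<in> T_PD A B L (xb k, yb k)"
        unfolding T_PD_def inv_op_def using inA[of k] inB[of k]
        by (force simp: diff_add_cancel)
      then have "- a * (w1 k \<bullet> w1 k) - b * (w2 k \<bullet> w2 k)
          \<le> w1 k \<bullet> (xb k - xs) + w2 k \<bullet> (yb k - ys)" by (rule minty)
      moreover have "c * D k \<le> c1 * (dx k \<bullet> dx k) + c2 * (dy k \<bullet> dy k)"
        unfolding D_def distrib_left by (intro add_mono mult_right_mono) (auto simp: c_def)
      moreover have "c1 * (dx k \<bullet> dx k) + c2 * (dy k \<bullet> dy k)
          \<le> cp_form a b L (dx k) (dy k) - a * (w1 k \<bullet> w1 k) - b * (w2 k \<bullet> w2 k)"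
        unfolding c1_def c2_def w1_def w2_def by (rule cp_form_coercive[OF ab(1,2)])
      \<comment> \<open>The error splits at the barred iterate: the first part gives
        \<open>cp_form\<close> because the residual is P applied to it, the second is controlled by
        \<open>minty\<close>.\<close>
      moreover have "w1 k \<bullet> (x k - xs) + w2 k \<bullet> (y k - ys)
          = cp_form a b L (dx k) (dy k) + (w1 k \<bullet> (xb k - xs) + w2 k \<bullet> (yb k - ys))"
        unfolding cp_form_eq_inner by (simp add: w1_def w2_def dx_def dy_def inner_diff_right)
      ultimately have "c * D k \<le> w1 k \<bullet> (x k - xs) + w2 k \<bullet> (y k - ys)"
        by linarith
      then have 1: "2 * t * (c * D k) \<le> 2 * t * (w1 k \<bullet> (x k - xs) + w2 k \<bullet> (y k - ys))"
        using t by (intro mult_left_mono) auto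
      have "t\<^sup>2 * cp_form a b L (dx k) (dy k) \<le> t\<^sup>2 * (C * D k)"
        unfolding C_def D_def by (intro mult_left_mono cp_form_le ab ab') simp
      also have "\<dots> = t * (c * D k)"
        using C by (simp add: t_def power2_eq_square)
      finally have 2: "t\<^sup>2 * cp_form a b L (dx k) (dy k) \<le> t * (c * D k)" .
      have "x (Suc k) = x k + t *\<^sub>R (xb k - x k)" "y (Suc k) = y k + t *\<^sub>R (yb k - y k)"
        using cpa unfolding CPA_def by blast+
      then have "x (Suc k) - xs = (x k - xs) - t *\<^sub>R dx k"
        "y (Suc k) - ys = (y k - ys) - t *\<^sub>R dy k"
        by (simp_all add: dx_def dy_def algebra_simps)
      then have "V (Suc k) = V k - 2 * t * (w1 k \<bullet> (x k - xs) + w2 k \<bullet> (y k - ys))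
          + t\<^sup>2 * cp_form a b L (dx k) (dy k)"
        unfolding V_def w1_def w2_def by (simp only: cp_form_shift)
      with 1 2 show ?thesis by (simp add: mult.assoc)
    qed
    have D: "D \<longlonglongrightarrow> 0"
    proof (rule telescoping_tendsto_0)
      show "0 \<le> V k" for k unfolding V_def by (rule cp_form_nonneg[OF ab(1,2) ab'])
      show "V (Suc k) \<le> V k - (t * c) * D k" for k by (rule step)
    qed (use c t in \<open>auto simp: D_def\<close>)
    have "(\<lambda>k. sqrt (D k)) \<longlonglongrightarrow> 0" using tendsto_real_sqrt[OF D] by simp
    then have "(\<lambda>k. norm (dx k, dy k)) \<longlonglongrightarrow> 0"
      by (simp add: norm_Pair D_def power2_norm_eq_inner)
    then have "(\<lambda>k. (dx k, dy k)) \<longlonglongrightarrow> (0, 0)"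
      by (simp add: tendsto_norm_zero_iff zero_prod_def)
    then have d: "dx \<longlonglongrightarrow> 0" "dy \<longlonglongrightarrow> 0"
      using tendsto_fst tendsto_snd by fastforce+
    have "(\<lambda>k. w1 k) \<longlonglongrightarrow> (1 / (2 * a)) *\<^sub>R 0 - transpose L *v 0"
      unfolding w1_def cp_w1_def
      by (intro tendsto_intros d bounded_linear.tendsto[OF matrix_vector_mul_bounded_linear])
    moreover have "(\<lambda>k. w2 k) \<longlonglongrightarrow> (1 / (2 * b)) *\<^sub>R 0 - L *v 0"
      unfolding w2_def cp_w2_def
      by (intro tendsto_intros d bounded_linear.tendsto[OF matrix_vector_mul_bounded_linear])
    ultimately show ?thesis
      using limit_point_in_zer_T_PD[OF osc _ _ inA inB p] by simp
  qed
  with t show ?thesis by blast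
qed

section \<open>Choice of the stepsizes\<close>

text \<open>The weak Minty constants may be zero while stepsizes must be positive; by continuity,
  adding a small \<open>e > 0\<close> to both keeps the strict inequality.\<close>

lemma exists_larger_product_less:
  fixes a b l :: real
  assumes "a \<ge> 0" "b \<ge> 0" "4 * a * b * l < 1"
  shows "\<exists>a'>0. \<exists>b'>0. a \<le> a' \<and> b \<le> b' \<and> 4 * a' * b' * l < 1"
proof -
  have "((\<lambda>e. 4 * (a + e) * (b + e) * l) \<longlongrightarrow> 4 * (a + 0) * (b + 0) * l) (at_right 0)"
    by (intro tendsto_intros)
  then have "\<forall>\<^sub>F e in at_right 0. 4 * (a + e) * (b + e) * l < 1"
    using assms(3) by (auto elim: order_tendstoD(2))
  then have "\<forall>\<^sub>F e in at_right 0. 0 < e \<and> 4 * (a + e) * (b + e) * l < 1"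
    using eventually_at_right_less[of "0::real"] by eventually_elim simp
  then obtain e where "0 < e" "4 * (a + e) * (b + e) * l < 1"
    using eventually_happens'[OF trivial_limit_at_right_real] by blast
  with assms(1,2) show ?thesis
    by (intro exI[of _ "a + e"] conjI exI[of _ "b + e"]) auto
qed

theorem theorem1p3:
  fixes L :: "real^'n^'m"
    and A :: "real^'n \<Rightarrow> (real^'n) set"
    and B :: "real^'m \<Rightarrow> (real^'m) set"
    and xs :: "real^'n" and ys :: "real^'m"
    and \<mu>A \<mu>B \<rho>A \<rho>B :: real
  assumes "L \<noteq> 0"
    and "outer_semicontinuous A"
    and "outer_semicontinuous B"
    and "(xs, ys) \<in> zer (T_PD A B L)"
    and "semimonotone_at (\<mu>A *\<^sub>R (transpose L ** L)) (\<rho>A *\<^sub>R mat 1) A xs (- (transpose L *v ys))"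
    and "semimonotone_at (\<mu>B *\<^sub>R mat 1) (\<rho>B *\<^sub>R (L ** transpose L)) B (L *v xs) ys"
    and "(\<mu>A = 0 \<and> \<mu>B = 0 \<and> \<rho>A = 0 \<and> \<rho>B = 0) \<or>
         (\<mu>A + \<mu>B > 0 \<and> \<rho>A = 0 \<and> \<rho>B = 0) \<or>
         (\<rho>A + \<rho>B > 0 \<and> \<mu>A = 0 \<and> \<mu>B = 0) \<or>
         (\<mu>A + \<mu>B > 0 \<and> \<rho>A + \<rho>B > 0 \<and>
          min 0 (\<mu>A * \<mu>B / (\<mu>A + \<mu>B)) * min 0 (\<rho>A * \<rho>B / (\<rho>A + \<rho>B))
            < 1 / (4 * (spectral_norm L)\<^sup>2))"
  shows "\<exists>\<gamma> \<tau> (lam :: nat \<Rightarrow> real).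
           \<gamma> > 0 \<and> \<tau> > 0 \<and> (\<forall>k. lam k > 0) \<and>
           (full_domain (resolvent (scale_op \<gamma> A)) \<and>
            full_domain (resolvent (scale_op \<tau> (inv_op B))) \<longrightarrow>
            (\<forall>x y xb yb. CPA A B L \<gamma> \<tau> lam x y xb yb \<longrightarrow>
               (\<exists>k. (xb k, yb k) \<in> zer (T_PD A B L)) \<or>
               (\<forall>p. seq_limit_point (\<lambda>k. (xb k, yb k)) p \<longrightarrow> p \<in> zer (T_PD A B L))))"
proof -
  \<comment> \<open>The default 0 covers a pair of vanishing moduli, so that the four conditions can
    be treated together.\<close>
  define par :: "real \<Rightarrow> real \<Rightarrow> real" where
    "par p q = (if p + q > 0 then - min 0 (p * q / (p + q)) else 0)" for p q
  have \<mu>: "\<mu>A + \<mu>B > 0 \<or> \<mu>A = 0 \<and> \<mu>B = 0" and \<rho>: "\<rho>B + \<rho>A > 0 \<or> \<rho>B = 0 \<and> \<rho>A = 0"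
    using assms(7) by auto
  have nonneg: "par p q \<ge> 0" for p q by (simp add: par_def)
  have "4 * par \<rho>B \<rho>A * par \<mu>A \<mu>B * (spectral_norm L)\<^sup>2 < 1"
  proof (cases "\<mu>A + \<mu>B > 0 \<and> \<rho>A + \<rho>B > 0")
    case False
    then show ?thesis by (auto simp: par_def add.commute)
  next
    case True
    define m where "m = par \<rho>B \<rho>A * par \<mu>A \<mu>B"
    \<comment> \<open>The two minus signs in \<open>par\<close> cancel in the product, which gives
      the left-hand side of the fourth condition.\<close>
    have "m = min 0 (\<mu>A * \<mu>B / (\<mu>A + \<mu>B)) * min 0 (\<rho>A * \<rho>B / (\<rho>A + \<rho>B))"
      using True by (simp add: m_def par_def add.commute mult.commute)
    with True assms(7) have m: "m < 1 / (4 * (spectral_norm L)\<^sup>2)" by auto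
    have "4 * m * (spectral_norm L)\<^sup>2 < 1"
      using m by (cases "spectral_norm L = 0") (simp_all add: field_simps)
    then show ?thesis by (simp add: m_def mult_ac)
  qed
  \<comment> \<open>The primal constant \<open>a\<close> comes from the \<rho> moduli and the dual
    constant \<open>b\<close> from the \<mu> moduli, matching the pairing in
    \<open>weak_minty\<close>.\<close>
  then obtain a b where ab: "a > 0" "b > 0" "par \<rho>B \<rho>A \<le> a" "par \<mu>A \<mu>B \<le> b"
    "4 * a * b * (spectral_norm L)\<^sup>2 < 1"
    using exists_larger_product_less[OF nonneg nonneg] by blast
  have "\<exists>t>0. \<forall>x y xb yb p. CPA A B L (2 * a) (2 * b) (\<lambda>_. t) x y xb yb \<longrightarrow>
      seq_limit_point (\<lambda>k. (xb k, yb k)) p \<longrightarrow> p \<in> zer (T_PD A B L)"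
    by (rule CPA_limit_points[OF assms(2,3) ab(1,2,5)])
      (rule weak_minty[OF assms(5,6) weak_parallel_sum_le[OF \<rho> par_def ab(3)]
          weak_parallel_sum_le[OF \<mu> par_def ab(4)]])
  then obtain t where "t > 0"
    and "\<forall>x y xb yb p. CPA A B L (2 * a) (2 * b) (\<lambda>_. t) x y xb yb \<longrightarrow>
      seq_limit_point (\<lambda>k. (xb k, yb k)) p \<longrightarrow> p \<in> zer (T_PD A B L)" by blast
  with ab show ?thesis
    by (intro exI[of _ "2 * a"] exI[of _ "2 * b"] exI[of _ "\<lambda>_. t"]) auto
qed

end
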